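(* Let $\{\eta_t\colon t\in\mathbb R\}$ be a stationary ergodic process taking values in $(0,\infty)$, with law $\mathbb P$, that is jointly measurable and has sample paths that are locally Lebesgue integrable in $t$. Define dynamical conductances on $\mathbb Z$ by $$a_t(x,x+1):=\eta_t,\quad x\in\mathbb Z,\ t\in\mathbb R.$$ If $\mathbb E\eta_0=\infty$, then for any $t>0$ and for $\mathbb P$-a.e. sample of the conductances, the random variables $\{n^{-1/2}X_{nt}\colon n\ge1\}$ are not tight under $P^0_a$.
   Context: Stationarity and ergodicity are with respect to time shifts. $a_t(x,x+1)=a_t(x+1,x)$. For a given sample $a$ of the conductances, $X=\{X_t\colon t\ge0\}$ is the (variable speed) continuous-time, time-inhomogeneous Markov chain on $\mathbb Z$ with time-dependent generator $(L_tf)(x)=\sum_{z=\pm1}a_t(x,x+z)[f(x+z)-f(x)]$, and $P^0_a$ is its law started from $X_0=0$. $\mathbb E$ is expectation with respect to $\mathbb P$. *)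

theory Defs
  imports "HOL-Probability.Probability"
begin

section \<open>Stationary and ergodic processes\<close>

definition path_space :: "(real \<Rightarrow> real) measure" where
  "path_space = (\<Pi>\<^sub>M t\<in>UNIV. borel)"

definition process_law :: "'w measure \<Rightarrow> (real \<Rightarrow> 'w \<Rightarrow> real) \<Rightarrow> (real \<Rightarrow> real) measure" where
  "process_law M \<eta> = distr M path_space (\<lambda>\<omega> t. \<eta> t \<omega>)"

definition time_shift :: "real \<Rightarrow> (real \<Rightarrow> real) \<Rightarrow> (real \<Rightarrow> real)" where
  "time_shift s w = (\<lambda>t. w (t + s))"

definition stationary_process :: "'w measure \<Rightarrow> (real \<Rightarrow> 'w \<Rightarrow> real) \<Rightarrow> bool" where
  "stationary_process M \<eta> \<longleftrightarrow>
     (\<forall>s. distr (process_law M \<eta>) path_space (time_shift s) = process_law M \<eta>)"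

text \<open>
  Invariance of an event is required only up to a null set, separately for each shift.
  Strict invariance would make the notion void: an event of the product \<open>\<sigma>\<close>-algebra is determined
  by countably many coordinates, so one that is strictly invariant under all real shifts is
  also determined by a disjoint countable set of coordinates and hence is empty or everything.
\<close>
definition ergodic_process :: "'w measure \<Rightarrow> (real \<Rightarrow> 'w \<Rightarrow> real) \<Rightarrow> bool" where
  "ergodic_process M \<eta> \<longleftrightarrow>
     (\<forall>A \<in> sets path_space.
        (\<forall>s. AE w in process_law M \<eta>. time_shift s w \<in> A \<longleftrightarrow> w \<in> A) \<longrightarrow>
        measure (process_law M \<eta>) A = 0 \<or> measure (process_law M \<eta>) A = 1)"


section \<open>The variable speed random walk among dynamical conductances\<close>

text \<open>\<open>a t x y\<close> is the conductance of the edge between \<open>x\<close> and \<open>y\<close> at time \<open>t\<close>; only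
  the values at nearest neighbours are ever used.\<close>
type_synonym conductances = "real \<Rightarrow> int \<Rightarrow> int \<Rightarrow> real"

definition generator :: "conductances \<Rightarrow> real \<Rightarrow> (int \<Rightarrow> real) \<Rightarrow> int \<Rightarrow> real" where
  "generator a t f x = (\<Sum>z\<in>{-1, 1}. a t x (x + z) * (f (x + z) - f x))"

text \<open>\<open>p s t x y\<close> is the probability of being at \<open>y\<close> at time \<open>t\<close> given the position \<open>x\<close> at
  time \<open>s\<close>.\<close>
definition transition_function :: "(real \<Rightarrow> real \<Rightarrow> int \<Rightarrow> int \<Rightarrow> real) \<Rightarrow> bool" where
  "transition_function p \<longleftrightarrow>
     (\<forall>s t x y. 0 \<le> s \<and> s \<le> t \<longrightarrow> 0 \<le> p s t x y) \<and>
     (\<forall>s t x. 0 \<le> s \<and> s \<le> t \<longrightarrow> (p s t x has_sum 1) UNIV) \<and>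
     (\<forall>s x y. 0 \<le> s \<longrightarrow> p s s x y = of_bool (x = y)) \<and>
     (\<forall>s t u x z. 0 \<le> s \<and> s \<le> t \<and> t \<le> u \<longrightarrow>
        ((\<lambda>y. p s t x y * p t u y z) has_sum p s u x z) UNIV)"

text \<open>
  The relation \<open>d/dt P\<^bsub>s,t\<^esub> f = P\<^bsub>s,t\<^esub> (L\<^sub>t f)\<close>, in integrated form since the
  conductances are only locally integrable in time. For finitely supported \<open>f\<close> both sums over
  \<open>y\<close> are finite.
\<close>
definition generated_by :: "conductances \<Rightarrow> (real \<Rightarrow> real \<Rightarrow> int \<Rightarrow> int \<Rightarrow> real) \<Rightarrow> bool" where
  "generated_by a p \<longleftrightarrow>
     (\<forall>s t x. \<forall>f :: int \<Rightarrow> real. 0 \<le> s \<and> s \<le> t \<and> finite {y. f y \<noteq> 0} \<longrightarrow>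
        set_integrable lborel {s..t} (\<lambda>u. \<Sum>\<^sub>\<infinity>y. p s u x y * generator a u f y) \<and>
        (\<Sum>\<^sub>\<infinity>y. p s t x y * f y) =
          f x + (LINT u:{s..t}|lborel. (\<Sum>\<^sub>\<infinity>y. p s u x y * generator a u f y)))"

definition natural_filtration :: "'x measure \<Rightarrow> (real \<Rightarrow> 'x \<Rightarrow> int) \<Rightarrow> real \<Rightarrow> 'x measure" where
  "natural_filtration Q X s = sigma (space Q) {X u -` B \<inter> space Q | u B. 0 \<le> u \<and> u \<le> s}"

text \<open>
  The process \<open>X\<close>, defined on the probability space \<open>Q\<close> and considered at times \<open>t \<ge> 0\<close>, is the
  Markov chain with time-dependent generator \<open>generator a t\<close> started from \<open>x0\<close>. Paths are right
  continuous with left limits in the discrete space \<open>int\<close>, so there is no explosion.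
\<close>
definition random_walk_among ::
  "conductances \<Rightarrow> int \<Rightarrow> 'x measure \<Rightarrow> (real \<Rightarrow> 'x \<Rightarrow> int) \<Rightarrow> bool" where
  "random_walk_among a x0 Q X \<longleftrightarrow>
     prob_space Q \<and>
     (\<forall>t\<ge>0. X t \<in> measurable Q (count_space UNIV)) \<and>
     (AE \<xi> in Q. X 0 \<xi> = x0) \<and>
     (AE \<xi> in Q. (\<forall>t\<ge>0. ((\<lambda>s. X s \<xi>) \<longlongrightarrow> X t \<xi>) (at_right t)) \<and>
                 (\<forall>t>0. \<exists>l. ((\<lambda>s. X s \<xi>) \<longlongrightarrow> l) (at_left t))) \<and>
     (\<exists>p. transition_function p \<and> generated_by a p \<and>
        (\<forall>s t y. 0 \<le> s \<and> s \<le> t \<longrightarrow>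
          (AE \<xi> in Q. real_cond_exp Q (natural_filtration Q X s)
                         (indicator {\<xi> \<in> space Q. X t \<xi> = y}) \<xi> = p s t (X s \<xi>) y)))"

end

theory Submission
  imports Defs
begin

text \<open>
  As all conductances at time \<open>u\<close> equal \<open>\<eta>\<^sub>u\<close>, the walk at time \<open>T\<close> is a simple random walk run with
  the clock \<open>\<Lambda>(T)\<close>, the integral of \<open>\<eta>\<close> over \<open>[0, T]\<close>; its typical displacement is of order
  \<open>sqrt \<Lambda>(T)\<close>. The claim thus follows once \<open>\<Lambda>(n t) / n\<close> is almost surely unbounded in \<open>n\<close>, and as
  tightness concerns all \<open>n\<close> at once, unboundedness along a subsequence that may depend on
  the sample is sufficient.

  For the clock, truncate \<open>\<eta>\<close> at a level \<open>k\<close>. The upper limit of the time averages of the truncated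
  process is shift invariant, hence by ergodicity at least the truncated mean almost surely: it
  would otherwise be below it almost surely, contradicting the reverse Fatou lemma
  (\<open>limsup_time_average_ge_mean\<close>). As the mean of \<open>\<eta>\<close> is infinite, the truncated means tend to
  infinity with \<open>k\<close> (\<open>unbounded_time_average\<close>). The delicate point is measurability: ergodicity
  speaks of events of the product \<open>\<sigma>\<close>-algebra on path space, to which time integrals do not belong.
  The lemma \<open>time_integral_is_path_functional\<close> replaces them by product-measurable functionals, in a way
  that is compatible with all shifts.

  For the walk, let \<open>\<phi>(T)\<close> be the expectation of \<open>cos (\<theta> X\<^sub>T)\<close>. The cosine is an eigenfunction of the
  generator, so the forward equation becomes a scalar linear equation for \<open>\<phi>\<close>
  (\<open>expected_cosine_rate_equation\<close>), which implies
  \<open>\<phi>(T) (1 + 2 (1 - cos \<theta>) \<Lambda>(T)) \<le> 1\<close> (\<open>expected_cosine_decay\<close>). With \<open>\<theta>\<close> of order \<open>1 / sqrt n\<close> and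
  \<open>T = n t\<close>, tightness would keep \<open>\<phi>(T)\<close> away from \<open>0\<close> and so keep \<open>\<Lambda>(n t) / n\<close> bounded.
\<close>

section \<open>Time integrals as functionals of the sample path\<close>

text \<open>
  The common value forces the integral of \<open>(X - Y)\<^sup>2\<close> to vanish. The functions are extended
  nonnegative ones because the moments in question are computed by Tonelli.
\<close>
lemma AE_eq_if_second_moments_agree:
  fixes X Y :: "'w \<Rightarrow> ennreal"
  assumes [measurable]: "X \<in> borel_measurable M" "Y \<in> borel_measurable M"
    and XX: "(\<integral>\<^sup>+\<omega>. X \<omega> * X \<omega> \<partial>M) = m" and XY: "(\<integral>\<^sup>+\<omega>. X \<omega> * Y \<omega> \<partial>M) = m"
    and YY: "(\<integral>\<^sup>+\<omega>. Y \<omega> * Y \<omega> \<partial>M) = m" and m: "m < \<infinity>"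
  shows "AE \<omega> in M. X \<omega> = Y \<omega>"
proof -
  \<comment> \<open>Finite values almost everywhere make the subtraction in \<open>(X - Y)\<^sup>2\<close> meaningful on the reals.\<close>
  define D where "D = (\<lambda>\<omega>. ennreal ((enn2real (X \<omega>) - enn2real (Y \<omega>))\<^sup>2))"
  have [measurable]: "D \<in> borel_measurable M"
    unfolding D_def by measurable
  have finX: "AE \<omega> in M. X \<omega> * X \<omega> \<noteq> \<infinity>"
    by (rule nn_integral_noteq_infinite) (use XX m in auto)
  have finY: "AE \<omega> in M. Y \<omega> * Y \<omega> \<noteq> \<infinity>"
    by (rule nn_integral_noteq_infinite) (use YY m in auto)
  have fin: "AE \<omega> in M. X \<omega> < \<infinity> \<and> Y \<omega> < \<infinity>"
    using finX finY by eventually_elim (auto simp: ennreal_mult_eq_top_iff less_top)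
  have expand: "AE \<omega> in M. D \<omega> + 2 * (X \<omega> * Y \<omega>) = X \<omega> * X \<omega> + Y \<omega> * Y \<omega>"
    using fin
  proof eventually_elim
    case (elim \<omega>)
    then obtain x y where xy: "X \<omega> = ennreal x" "Y \<omega> = ennreal y" "0 \<le> x" "0 \<le> y"
      by (metis ennreal_cases infinity_ennreal_def less_irrefl)
    have "ennreal ((x - y)\<^sup>2) + 2 * (ennreal x * ennreal y) = ennreal ((x - y)\<^sup>2 + 2 * (x * y))"
      using xy by (simp add: ennreal_mult ennreal_plus flip: ennreal_numeral)
    also have "(x - y)\<^sup>2 + 2 * (x * y) = x * x + y * y"
      by (simp add: power2_eq_square algebra_simps)
    finally show ?case
      using xy by (simp add: D_def ennreal_mult ennreal_plus)
  qed
  have "(\<integral>\<^sup>+\<omega>. D \<omega> \<partial>M) + 2 * m = (\<integral>\<^sup>+\<omega>. D \<omega> + 2 * (X \<omega> * Y \<omega>) \<partial>M)"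
    using XY by (simp add: nn_integral_add nn_integral_cmult)
  also have "\<dots> = (\<integral>\<^sup>+\<omega>. X \<omega> * X \<omega> + Y \<omega> * Y \<omega> \<partial>M)"
    by (rule nn_integral_cong_AE[OF expand])
  also have "\<dots> = 0 + 2 * m"
    using XX YY by (simp add: nn_integral_add mult_2)
  finally have "(\<integral>\<^sup>+\<omega>. D \<omega> \<partial>M) = 0"
    using m by (subst (asm) add.commute, subst (asm) (2) add.commute)
      (auto simp: ennreal_add_left_cancel ennreal_mult_eq_top_iff)
  then have "AE \<omega> in M. D \<omega> = 0"
    by (simp add: nn_integral_0_iff_AE)
  then show ?thesis
    using fin
  proof eventually_elim
    case (elim \<omega>)
    then have "enn2real (X \<omega>) = enn2real (Y \<omega>)"
      by (simp add: D_def)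
    then show ?case
      using elim by (metis ennreal_enn2real infinity_ennreal_def)
  qed
qed

locale measurable_stationary_process = prob_space M
  for M :: "'w measure" and \<eta> :: "real \<Rightarrow> 'w \<Rightarrow> real" +
  assumes jointly_measurable: "(\<lambda>(s, \<omega>). \<eta> s \<omega>) \<in> borel_measurable (borel \<Otimes>\<^sub>M M)"
    and stationary: "stationary_process M \<eta>"
begin

lemma measurable_time_shift [measurable]: "time_shift s \<in> measurable path_space path_space"
  unfolding path_space_def time_shift_def
  by (intro measurable_PiM_single') (auto simp: space_PiM)

lemma measurable_coordinate [measurable]: "(\<lambda>w. w u) \<in> borel_measurable path_space"
  unfolding path_space_def by simp

abbreviation sample_path :: "'w \<Rightarrow> real \<Rightarrow> real" where
  "sample_path \<omega> \<equiv> (\<lambda>s. \<eta> s \<omega>)"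

lemma process_measurable [measurable (raw)]:
  assumes [measurable]: "f \<in> borel_measurable N" "g \<in> measurable N M"
  shows "(\<lambda>x. \<eta> (f x) (g x)) \<in> borel_measurable N"
proof -
  have "(\<lambda>x. (f x, g x)) \<in> measurable N (borel \<Otimes>\<^sub>M M)"
    by measurable
  from measurable_compose[OF this jointly_measurable] show ?thesis
    by simp
qed

lemma time_section_measurable:
  assumes "\<omega> \<in> space M"
  shows "(\<lambda>u. \<eta> (u + s) \<omega>) \<in> borel_measurable borel"
  by (rule process_measurable) (use assms in simp_all)

lemma sample_path_measurable [measurable]: "sample_path \<in> measurable M path_space"
  unfolding path_space_def by (intro measurable_PiM_single') (auto simp: space_PiM)

lemma sets_process_law [simp, measurable_cong]: "sets (process_law M \<eta>) = sets path_space"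
  by (simp add: process_law_def)

lemma prob_space_process_law: "prob_space (process_law M \<eta>)"
  unfolding process_law_def by (rule prob_space_distr) measurable

lemma nn_integral_time_shift:
  assumes [measurable]: "F \<in> borel_measurable path_space"
  shows "(\<integral>\<^sup>+\<omega>. F (time_shift s (sample_path \<omega>)) \<partial>M) = (\<integral>\<^sup>+\<omega>. F (sample_path \<omega>) \<partial>M)"
proof -
  have "(\<integral>\<^sup>+\<omega>. F (time_shift s (sample_path \<omega>)) \<partial>M)
      = (\<integral>\<^sup>+w. F w \<partial>distr (process_law M \<eta>) path_space (time_shift s))"
    by (simp add: process_law_def nn_integral_distr)
  also have "\<dots> = (\<integral>\<^sup>+w. F w \<partial>process_law M \<eta>)"
    using stationary by (simp add: stationary_process_def)
  also have "\<dots> = (\<integral>\<^sup>+\<omega>. F (sample_path \<omega>) \<partial>M)"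
    by (simp add: process_law_def nn_integral_distr)
  finally show ?thesis .
qed

text \<open>
  An integral over a time interval involves uncountably many coordinates, so it is not a measurable
  function on the product \<open>\<sigma>\<close>-algebra; almost surely, however, it agrees with one, and this is
  what makes ergodicity applicable to it. Write \<open>I s\<close> for the integral over the window
  starting at time \<open>s\<close>. The functional \<open>J\<close> is the conditional expectation of \<open>I 0\<close> given
  the path, obtained as a Radon-Nikodym density; so every path functional has the same inner
  product with \<open>I 0\<close> as with \<open>J(\<eta>)\<close>. Applied to \<open>J\<close> itself, and by Tonelli to the integrand at each
  time, this shows that the second moments of \<open>I 0\<close> and \<open>J(\<eta>)\<close> and their mixed moment all
  coincide, so the two are almost surely equal.
  That the same \<open>J\<close> also serves all shifted windows does not follow from equality in law of the
  shifted paths alone, because \<open>I s\<close> is not yet known to depend on the path only; but Tonelli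
  expresses each of the three moments by expectations of path functionals, which are invariant
  under the shift.
\<close>
lemma time_integral_is_path_functional:
  fixes g :: "real \<Rightarrow> ennreal"
  assumes [measurable]: "g \<in> borel_measurable borel" and bound: "\<And>x. g x \<le> ennreal K"
  obtains J where "J \<in> borel_measurable path_space"
    "\<And>s. AE \<omega> in M. J (time_shift s (sample_path \<omega>)) = (\<integral>\<^sup>+u\<in>{0..T}. g (\<eta> (u + s) \<omega>) \<partial>lborel)"
proof -
  define I where "I s \<omega> = (\<integral>\<^sup>+u\<in>{0..T}. g (\<eta> (u + s) \<omega>) \<partial>lborel)" for s \<omega>
  have I_measurable [measurable]: "I s \<in> borel_measurable M" for s
    unfolding I_def by measurable
  define \<nu> where "\<nu> = distr (density M (I 0)) path_space sample_path"
  define J where "J = RN_deriv (process_law M \<eta>) \<nu>"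
  interpret law: prob_space "process_law M \<eta>"
    by (rule prob_space_process_law)
  have [measurable]: "J \<in> borel_measurable path_space"
    unfolding J_def using borel_measurable_RN_deriv[of "process_law M \<eta>"]
    by (simp cong: measurable_cong_sets)
  have nn_integral_\<nu>: "(\<integral>\<^sup>+w. F w \<partial>\<nu>) = (\<integral>\<^sup>+\<omega>. I 0 \<omega> * F (sample_path \<omega>) \<partial>M)"
    if [measurable]: "F \<in> borel_measurable path_space" for F
    unfolding \<nu>_def by (simp add: nn_integral_distr nn_integral_density)
  have ac: "absolutely_continuous (process_law M \<eta>) \<nu>"
    unfolding absolutely_continuous_def
  proof
    fix B assume B: "B \<in> null_sets (process_law M \<eta>)"
    then have [measurable]: "B \<in> sets path_space"
      by auto
    have "0 = emeasure (process_law M \<eta>) B"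
      using B by auto
    also have "\<dots> = (\<integral>\<^sup>+\<omega>. indicator B (sample_path \<omega>) \<partial>M)"
      by (simp add: process_law_def nn_integral_distr flip: nn_integral_indicator)
    finally have "AE \<omega> in M. indicator B (sample_path \<omega>) = (0::ennreal)"
      by (subst (asm) eq_commute, subst (asm) nn_integral_0_iff_AE) auto
    then have "(\<integral>\<^sup>+\<omega>. I 0 \<omega> * indicator B (sample_path \<omega>) \<partial>M) = 0"
      by (subst nn_integral_0_iff_AE) auto
    then have "emeasure \<nu> B = 0"
      using nn_integral_\<nu>[of "indicator B"] by (simp add: \<nu>_def)
    then show "B \<in> null_sets \<nu>"
      by (auto simp: \<nu>_def)
  qed
  have density_J: "(\<integral>\<^sup>+\<omega>. J (sample_path \<omega>) * F (sample_path \<omega>) \<partial>M) = (\<integral>\<^sup>+\<omega>. I 0 \<omega> * F (sample_path \<omega>) \<partial>M)"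
    if F [measurable]: "F \<in> borel_measurable path_space" for F
  proof -
    have "(\<integral>\<^sup>+\<omega>. J (sample_path \<omega>) * F (sample_path \<omega>) \<partial>M) = (\<integral>\<^sup>+w. J w * F w \<partial>process_law M \<eta>)"
      by (simp add: process_law_def nn_integral_distr)
    also have "\<dots> = (\<integral>\<^sup>+w. F w \<partial>\<nu>)"
      unfolding J_def by (rule law.RN_deriv_nn_integral[symmetric, OF ac]) (simp_all add: \<nu>_def)
    finally show ?thesis
      by (simp add: nn_integral_\<nu>)
  qed
  have Tonelli: "(\<integral>\<^sup>+\<omega>. I s \<omega> * Z \<omega> \<partial>M) = (\<integral>\<^sup>+u\<in>{0..T}. (\<integral>\<^sup>+\<omega>. g (\<eta> (u + s) \<omega>) * Z \<omega> \<partial>M) \<partial>lborel)"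
    if [measurable]: "Z \<in> borel_measurable M" for s Z
  proof -
    interpret P: pair_sigma_finite M lborel ..
    have "(\<integral>\<^sup>+\<omega>. I s \<omega> * Z \<omega> \<partial>M)
        = (\<integral>\<^sup>+\<omega>. (\<integral>\<^sup>+u. g (\<eta> (u + s) \<omega>) * indicator {0..T} u * Z \<omega> \<partial>lborel) \<partial>M)"
      unfolding I_def by (intro nn_integral_cong nn_integral_multc[symmetric]) (simp add: time_section_measurable)
    also have "\<dots> = (\<integral>\<^sup>+u. (\<integral>\<^sup>+\<omega>. g (\<eta> (u + s) \<omega>) * indicator {0..T} u * Z \<omega> \<partial>M) \<partial>lborel)"
      by (rule P.Fubini'[symmetric]) measurable
    also have "\<dots> = (\<integral>\<^sup>+u\<in>{0..T}. (\<integral>\<^sup>+\<omega>. g (\<eta> (u + s) \<omega>) * Z \<omega> \<partial>M) \<partial>lborel)"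
      by (intro nn_integral_cong) (simp split: split_indicator)
    finally show ?thesis .
  qed
  have shift_IJ: "(\<integral>\<^sup>+\<omega>. I s \<omega> * J (time_shift s (sample_path \<omega>)) \<partial>M) = (\<integral>\<^sup>+\<omega>. I 0 \<omega> * J (sample_path \<omega>) \<partial>M)" for s
  proof -
    have "(\<integral>\<^sup>+\<omega>. g (\<eta> (u + s) \<omega>) * J (time_shift s (sample_path \<omega>)) \<partial>M)
        = (\<integral>\<^sup>+\<omega>. g (\<eta> (u + 0) \<omega>) * J (sample_path \<omega>) \<partial>M)" for u
      using nn_integral_time_shift[of "\<lambda>w. g (w u) * J w" s] by (simp add: time_shift_def)
    then show ?thesis
      by (simp add: Tonelli)
  qed
  have shift_II: "(\<integral>\<^sup>+\<omega>. I s \<omega> * I s \<omega> \<partial>M) = (\<integral>\<^sup>+\<omega>. I 0 \<omega> * I 0 \<omega> \<partial>M)" for s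
  proof -
    have "(\<integral>\<^sup>+\<omega>. g (\<eta> (u + s) \<omega>) * I s \<omega> \<partial>M) = (\<integral>\<^sup>+\<omega>. g (\<eta> (u + 0) \<omega>) * I 0 \<omega> \<partial>M)" for u
    proof -
      have "(\<integral>\<^sup>+\<omega>. g (\<eta> (v + s) \<omega>) * g (\<eta> (u + s) \<omega>) \<partial>M)
          = (\<integral>\<^sup>+\<omega>. g (\<eta> (v + 0) \<omega>) * g (\<eta> (u + 0) \<omega>) \<partial>M)" for v
        using nn_integral_time_shift[of "\<lambda>w. g (w v) * g (w u)" s] by (simp add: time_shift_def)
      then show ?thesis
        by (simp add: mult.commute[of _ "I _ _"] Tonelli)
    qed
    then show ?thesis
      by (simp add: Tonelli)
  qed
  have II_IJ: "(\<integral>\<^sup>+\<omega>. I 0 \<omega> * I 0 \<omega> \<partial>M) = (\<integral>\<^sup>+\<omega>. I 0 \<omega> * J (sample_path \<omega>) \<partial>M)"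
  proof -
    have "(\<integral>\<^sup>+\<omega>. g (\<eta> u \<omega>) * I 0 \<omega> \<partial>M) = (\<integral>\<^sup>+\<omega>. g (\<eta> u \<omega>) * J (sample_path \<omega>) \<partial>M)" for u
      using density_J[of "\<lambda>w. g (w u)"] by (simp add: mult.commute)
    then show ?thesis
      by (simp add: Tonelli)
  qed
  have JJ_IJ: "(\<integral>\<^sup>+\<omega>. J (time_shift s (sample_path \<omega>)) * J (time_shift s (sample_path \<omega>)) \<partial>M)
      = (\<integral>\<^sup>+\<omega>. I 0 \<omega> * J (sample_path \<omega>) \<partial>M)" for s
    using nn_integral_time_shift[of "\<lambda>w. J w * J w" s] density_J[of J] by simp
  have I_bound: "I 0 \<omega> \<le> ennreal K * emeasure lborel {0..T}" for \<omega>
  proof -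
    have "I 0 \<omega> \<le> (\<integral>\<^sup>+u\<in>{0..T}. ennreal K \<partial>lborel)"
      unfolding I_def by (intro nn_integral_mono mult_right_mono bound) auto
    then show ?thesis
      by (simp add: nn_integral_cmult)
  qed
  have "(\<integral>\<^sup>+\<omega>. I 0 \<omega> * I 0 \<omega> \<partial>M)
      \<le> (\<integral>\<^sup>+\<omega>. (ennreal K * emeasure lborel {0..T}) * (ennreal K * emeasure lborel {0..T}) \<partial>M)"
    by (intro nn_integral_mono mult_mono I_bound) auto
  also have "\<dots> < \<infinity>"
    by (simp add: ennreal_mult_less_top emeasure_space_1 emeasure_lborel_Icc_eq)
  finally have fin: "(\<integral>\<^sup>+\<omega>. I 0 \<omega> * I 0 \<omega> \<partial>M) < \<infinity>" .
  have "AE \<omega> in M. J (time_shift s (sample_path \<omega>)) = I s \<omega>" for s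
  proof (rule AE_eq_if_second_moments_agree[OF _ _ _ _ _ fin])
    show "(\<integral>\<^sup>+\<omega>. J (time_shift s (sample_path \<omega>)) * I s \<omega> \<partial>M) = (\<integral>\<^sup>+\<omega>. I 0 \<omega> * I 0 \<omega> \<partial>M)"
      using shift_IJ II_IJ by (simp add: mult.commute)
  qed (simp_all add: JJ_IJ II_IJ shift_II)
  then show ?thesis
    using that[of J] by (simp add: I_def)
qed

end

section \<open>Time averages of an ergodic process\<close>

lemma limsup_le_limsup_if_dominated_up_to_null_sequence:
  fixes x y z :: "nat \<Rightarrow> ennreal"
  assumes le: "\<And>n. x n \<le> y n + z n" and z: "z \<longlonglongrightarrow> 0"
  shows "limsup x \<le> limsup y"
  unfolding Limsup_le_iff
proof (intro allI impI)
  fix c assume "limsup y < c"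
  then obtain d where d: "limsup y < d" "d < c"
    using dense by blast
  have "eventually (\<lambda>n. z n < c - d) sequentially"
    using d(2) by (intro order_tendstoD(2)[OF z]) (simp add: diff_gr0_ennreal)
  then show "eventually (\<lambda>n. x n < c) sequentially"
    using Limsup_lessD[OF d(1)]
  proof eventually_elim
    case (elim n)
    have "x n \<le> y n + z n"
      by (rule le)
    also have "\<dots> < d + (c - d)"
      using elim by (intro add_strict_mono)
    also have "\<dots> = c"
      using d(2) by (simp add: ennreal_add_diff_cancel_right less_imp_le add_diff_inverse_ennreal)
    finally show ?case .
  qed
qed

text \<open>The part of the first window outside the second has length at most \<open>\<bar>a - b\<bar>\<close>.\<close>
lemma nn_integral_shifted_window_le:
  fixes h :: "real \<Rightarrow> ennreal"
  assumes [measurable]: "h \<in> borel_measurable borel" and bound: "\<And>u. h u \<le> ennreal K"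
    and T: "0 \<le> T"
  shows "(\<integral>\<^sup>+u\<in>{a..a + T}. h u \<partial>lborel)
      \<le> (\<integral>\<^sup>+u\<in>{b..b + T}. h u \<partial>lborel) + ennreal K * ennreal \<bar>a - b\<bar>"
proof -
  define E where "E = {a..a + T} - {b..b + T}"
  have E: "emeasure lborel E \<le> ennreal \<bar>a - b\<bar>"
  proof (cases "a \<le> b")
    case True
    then have "E \<subseteq> {a..<b}"
      unfolding E_def by auto
    then have "emeasure lborel E \<le> emeasure lborel {a..<b}"
      by (intro emeasure_mono) auto
    then show ?thesis
      using True by simp
  next
    case False
    then have "E \<subseteq> {b + T<..a + T}"
      unfolding E_def by auto
    then have "emeasure lborel E \<le> emeasure lborel {b + T<..a + T}"
      by (intro emeasure_mono) auto
    then show ?thesis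
      using False by simp
  qed
  have [measurable]: "E \<in> sets borel"
    unfolding E_def by simp
  have "(\<integral>\<^sup>+u\<in>{a..a + T}. h u \<partial>lborel)
      \<le> (\<integral>\<^sup>+u. h u * indicator {b..b + T} u + ennreal K * indicator E u \<partial>lborel)"
    using bound by (intro nn_integral_mono) (auto simp: E_def split: split_indicator)
  also have "\<dots> = (\<integral>\<^sup>+u\<in>{b..b + T}. h u \<partial>lborel) + ennreal K * emeasure lborel E"
    by (subst nn_integral_add) (auto simp: nn_integral_cmult)
  also have "\<dots> \<le> (\<integral>\<^sup>+u\<in>{b..b + T}. h u \<partial>lborel) + ennreal K * ennreal \<bar>a - b\<bar>"
    by (intro add_left_mono mult_left_mono E) simp
  finally show ?thesis .
qed

lemma nn_integral_time_translation:
  fixes h :: "real \<Rightarrow> ennreal"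
  assumes [measurable]: "h \<in> borel_measurable borel"
  shows "(\<integral>\<^sup>+u\<in>{0..T}. h (u + s) \<partial>lborel) = (\<integral>\<^sup>+u\<in>{s..s + T}. h u \<partial>lborel)"
proof -
  have "(\<integral>\<^sup>+u\<in>{s..s + T}. h u \<partial>lborel) = (\<integral>\<^sup>+u. h (s + 1 * u) * indicator {s..s + T} (s + 1 * u) \<partial>lborel)"
    using nn_integral_real_affine[of "\<lambda>u. h u * indicator {s..s + T} u" 1 s] by simp
  also have "\<dots> = (\<integral>\<^sup>+u\<in>{0..T}. h (u + s) \<partial>lborel)"
    by (intro nn_integral_cong) (simp add: add.commute split: split_indicator)
  finally show ?thesis ..
qed

context measurable_stationary_process
begin

text \<open>
  For bounded \<open>g\<close> the upper limit \<open>L\<close> of the averages is unchanged, up to null sets, by shifts, since moving the window of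
  integration by \<open>s\<close> changes the integral by at most \<open>K * \<bar>s\<bar>\<close>. Hence \<open>L \<ge> c\<close> has
  probability zero or one, where \<open>c\<close> is the expectation of every single average. Probability
  zero is excluded by the reverse Fatou lemma, which gives \<open>L\<close> an expectation of at least \<open>c\<close>.
\<close>
lemma limsup_time_average_ge_mean:
  fixes g :: "real \<Rightarrow> ennreal"
  assumes ergodic: "ergodic_process M \<eta>"
    and [measurable]: "g \<in> borel_measurable borel" and bound: "\<And>x. g x \<le> ennreal K"
    and t: "0 < t"
  shows "AE \<omega> in M. ennreal t * (\<integral>\<^sup>+\<omega>'. g (\<eta> 0 \<omega>') \<partial>M)
    \<le> limsup (\<lambda>n. (\<integral>\<^sup>+u\<in>{0..real (Suc n) * t}. g (\<eta> u \<omega>) \<partial>lborel) / ennreal (real (Suc n)))"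
proof -
  define I where "I n s \<omega> = (\<integral>\<^sup>+u\<in>{0..real (Suc n) * t}. g (\<eta> (u + s) \<omega>) \<partial>lborel)" for n s \<omega>
  have [measurable]: "I n s \<in> borel_measurable M" for n s
    unfolding I_def by measurable
  have "\<exists>F. F \<in> borel_measurable path_space \<and>
      (\<forall>s. AE \<omega> in M. F (time_shift s (sample_path \<omega>)) = I n s \<omega>)" for n
    unfolding I_def
    by (rule time_integral_is_path_functional[OF assms(2) bound, of "real (Suc n) * t"]) blast
  then have "\<exists>J. \<forall>n. J n \<in> borel_measurable path_space \<and>
      (\<forall>s. AE \<omega> in M. J n (time_shift s (sample_path \<omega>)) = I n s \<omega>)"
    by (intro choice allI)
  then obtain J where [measurable]: "\<And>n. J n \<in> borel_measurable path_space"
    and J: "\<And>n s. AE \<omega> in M. J n (time_shift s (sample_path \<omega>)) = I n s \<omega>"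
    by blast
  have J_all: "AE \<omega> in M. \<forall>n. J n (time_shift s (sample_path \<omega>)) = I n s \<omega>" for s
    using J by (simp add: AE_all_countable)
  define c where "c = ennreal t * (\<integral>\<^sup>+\<omega>. g (\<eta> 0 \<omega>) \<partial>M)"
  define L where "L \<omega> = limsup (\<lambda>n. I n 0 \<omega> / ennreal (real (Suc n)))" for \<omega>
  define A where "A = {w \<in> space path_space. c \<le> limsup (\<lambda>n. J n w / ennreal (real (Suc n)))}"
  have [measurable]: "L \<in> borel_measurable M"
    unfolding L_def by measurable
  have A [measurable]: "A \<in> sets path_space"
    unfolding A_def by measurable
  have limsup_I_le: "limsup (\<lambda>n. I n s \<omega> / ennreal (real (Suc n))) \<le> limsup (\<lambda>n. I n r \<omega> / ennreal (real (Suc n)))"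
    if \<omega>: "\<omega> \<in> space M" for s r \<omega>
  proof (rule limsup_le_limsup_if_dominated_up_to_null_sequence)
    have meas: "(\<lambda>u. g (\<eta> u \<omega>)) \<in> borel_measurable borel"
      using time_section_measurable[OF \<omega>, of 0] by simp
    show "I n s \<omega> / ennreal (real (Suc n)) \<le> I n r \<omega> / ennreal (real (Suc n))
        + ennreal K * ennreal \<bar>s - r\<bar> / ennreal (real (Suc n))" for n
      using nn_integral_shifted_window_le[OF meas bound, of "real (Suc n) * t" s r] t
      unfolding I_def add_divide_distrib_ennreal[symmetric]
      by (intro divide_right_mono_ennreal) (simp add: nn_integral_time_translation[OF meas])
    have "(\<lambda>n. ennreal ((max 0 K * \<bar>s - r\<bar>) / real (Suc n))) \<longlonglongrightarrow> ennreal 0"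
      by (intro tendsto_ennrealI LIMSEQ_Suc lim_const_over_n)
    moreover have "ennreal K * ennreal \<bar>s - r\<bar> / ennreal (real (Suc n)) = ennreal ((max 0 K * \<bar>s - r\<bar>) / real (Suc n))" for n
    proof -
      have "ennreal K = ennreal (max 0 K)"
        by (simp add: max_def ennreal_neg)
      then have *: "ennreal K * ennreal \<bar>s - r\<bar> = ennreal (max 0 K * \<bar>s - r\<bar>)"
        by (simp add: ennreal_mult)
      show ?thesis
        unfolding * by (rule divide_ennreal) auto
    qed
    ultimately show "(\<lambda>n. ennreal K * ennreal \<bar>s - r\<bar> / ennreal (real (Suc n))) \<longlonglongrightarrow> 0"
      by simp
  qed
  have in_A: "AE \<omega> in M. time_shift s (sample_path \<omega>) \<in> A \<longleftrightarrow> c \<le> L \<omega>" for s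
    using J_all[of s] AE_space
  proof eventually_elim
    case (elim \<omega>)
    have "time_shift s (sample_path \<omega>) \<in> space path_space"
      by (simp add: path_space_def space_PiM)
    moreover have "limsup (\<lambda>n. J n (time_shift s (sample_path \<omega>)) / ennreal (real (Suc n))) = L \<omega>"
      unfolding L_def using elim by (auto intro: antisym limsup_I_le simp del: of_nat_Suc)
    ultimately show ?case
      by (simp add: A_def)
  qed
  have time_shift_0: "time_shift 0 w = w" for w
    by (simp add: time_shift_def)
  have "AE w in process_law M \<eta>. time_shift s w \<in> A \<longleftrightarrow> w \<in> A" for s
  proof -
    have "AE \<omega> in M. time_shift s (sample_path \<omega>) \<in> A \<longleftrightarrow> sample_path \<omega> \<in> A"
      using in_A[of s] in_A[of 0] by eventually_elim (simp add: time_shift_0)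
    then show ?thesis
      unfolding process_law_def by (subst AE_distr_iff) measurable
  qed
  then have zero_one: "measure (process_law M \<eta>) A = 0 \<or> measure (process_law M \<eta>) A = 1"
    using ergodic A unfolding ergodic_process_def by blast
  interpret law: prob_space "process_law M \<eta>"
    by (rule prob_space_process_law)
  have mean_I: "(\<integral>\<^sup>+\<omega>. I n 0 \<omega> / ennreal (real (Suc n)) \<partial>M) = c" for n
  proof -
    interpret P: pair_sigma_finite M lborel ..
    have mean: "(\<integral>\<^sup>+\<omega>. g (\<eta> u \<omega>) \<partial>M) = (\<integral>\<^sup>+\<omega>. g (\<eta> 0 \<omega>) \<partial>M)" for u
      using nn_integral_time_shift[of "\<lambda>w. g (w 0)" u] by (simp add: time_shift_def)
    have "(\<integral>\<^sup>+\<omega>. I n 0 \<omega> \<partial>M)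
        = (\<integral>\<^sup>+u. (\<integral>\<^sup>+\<omega>. g (\<eta> (u + 0) \<omega>) * indicator {0..real (Suc n) * t} u \<partial>M) \<partial>lborel)"
      unfolding I_def by (rule P.Fubini'[symmetric]) measurable
    also have "\<dots> = (\<integral>\<^sup>+u\<in>{0..real (Suc n) * t}. (\<integral>\<^sup>+\<omega>. g (\<eta> 0 \<omega>) \<partial>M) \<partial>lborel)"
    proof (rule nn_integral_cong)
      fix u
      show "(\<integral>\<^sup>+\<omega>. g (\<eta> (u + 0) \<omega>) * indicator {0..real (Suc n) * t} u \<partial>M)
          = (\<integral>\<^sup>+\<omega>. g (\<eta> 0 \<omega>) \<partial>M) * indicator {0..real (Suc n) * t} u"
        using mean[of u] by (simp add: nn_integral_multc del: of_nat_Suc)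
    qed
    also have "\<dots> = ennreal (real (Suc n)) * c"
      using t by (simp add: nn_integral_cmult c_def ennreal_mult ac_simps del: of_nat_Suc)
    finally have "(\<integral>\<^sup>+\<omega>. I n 0 \<omega> \<partial>M) = ennreal (real (Suc n)) * c" .
    then show ?thesis
      by (simp add: nn_integral_divide ennreal_mult_divide_eq mult.commute[of _ c] del: of_nat_Suc)
  qed
  have I_bound: "I n 0 \<omega> / ennreal (real (Suc n)) \<le> ennreal K * ennreal t" for n \<omega>
  proof -
    have "I n 0 \<omega> \<le> (\<integral>\<^sup>+u\<in>{0..real (Suc n) * t}. ennreal K \<partial>lborel)"
      unfolding I_def by (intro nn_integral_mono mult_right_mono bound) auto
    also have "\<dots> = (ennreal K * ennreal t) * ennreal (real (Suc n))"
      using t by (simp add: nn_integral_cmult ennreal_mult ac_simps del: of_nat_Suc)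
    finally have "I n 0 \<omega> / ennreal (real (Suc n))
        \<le> (ennreal K * ennreal t) * ennreal (real (Suc n)) / ennreal (real (Suc n))"
      by (rule divide_right_mono_ennreal)
    then show ?thesis
      by (simp add: ennreal_mult_divide_eq del: of_nat_Suc)
  qed
  have fatou: "c \<le> (\<integral>\<^sup>+\<omega>. L \<omega> \<partial>M)"
  proof -
    have "limsup (\<lambda>n. \<integral>\<^sup>+\<omega>. I n 0 \<omega> / ennreal (real (Suc n)) \<partial>M) \<le> (\<integral>\<^sup>+\<omega>. L \<omega> \<partial>M)"
      unfolding L_def
      by (rule nn_integral_limsup[where w = "\<lambda>_. ennreal K * ennreal t"])
        (auto simp: I_bound emeasure_space_1 ennreal_mult_less_top simp del: of_nat_Suc)
    then show ?thesis
      by (simp add: mean_I Limsup_const del: of_nat_Suc)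
  qed
  have "measure (process_law M \<eta>) A \<noteq> 0"
  proof
    assume "measure (process_law M \<eta>) A = 0"
    then have "AE w in process_law M \<eta>. w \<notin> A"
      by (simp add: law.prob_eq_0)
    then have "AE \<omega> in M. sample_path \<omega> \<notin> A"
      unfolding process_law_def by (subst (asm) AE_distr_iff) auto
    with in_A[of 0] have L_less: "AE \<omega> in M. L \<omega> < c"
      by eventually_elim (simp add: time_shift_0 not_le)
    have not_ge: "\<not> (AE \<omega> in M. c \<le> L \<omega>)"
    proof
      assume "AE \<omega> in M. c \<le> L \<omega>"
      with L_less have "AE \<omega> in M. False"
        by eventually_elim simp
      then show False
        by simp
    qed
    have "c \<le> (\<integral>\<^sup>+\<omega>. ennreal K * ennreal t \<partial>M)"
      unfolding mean_I[of 0, symmetric] by (intro nn_integral_mono I_bound)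
    then have "c \<le> ennreal K * ennreal t"
      by (simp add: emeasure_space_1)
    then have c_finite: "c < \<infinity>"
      by (simp add: le_less_trans ennreal_mult_less_top)
    have "(\<integral>\<^sup>+\<omega>. L \<omega> \<partial>M) \<le> (\<integral>\<^sup>+\<omega>. c \<partial>M)"
      using L_less by (intro nn_integral_mono_AE) (auto elim: eventually_mono)
    then have "(\<integral>\<^sup>+\<omega>. L \<omega> \<partial>M) \<noteq> \<infinity>"
      using c_finite by (auto simp: emeasure_space_1 top_unique)
    then have "(\<integral>\<^sup>+\<omega>. L \<omega> \<partial>M) < (\<integral>\<^sup>+\<omega>. c \<partial>M)"
      using L_less by (intro nn_integral_less not_ge) (auto elim: eventually_mono)
    with fatou show False
      by (simp add: emeasure_space_1)
  qed
  with zero_one have "AE w in process_law M \<eta>. w \<in> A"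
    by (simp add: law.prob_eq_1)
  then have "AE \<omega> in M. sample_path \<omega> \<in> A"
    unfolding process_law_def by (subst (asm) AE_distr_iff) auto
  with in_A[of 0] show ?thesis
    unfolding L_def I_def c_def by eventually_elim (simp add: time_shift_0)
qed

text \<open>
  Truncate at level \<open>k\<close>: the averages of the process exceed those of the truncated one, whose
  upper limit is at least \<open>t\<close> times the truncated mean, and the latter grows to infinity with \<open>k\<close>.
\<close>
lemma unbounded_time_average:
  assumes ergodic: "ergodic_process M \<eta>"
    and nonneg: "\<And>s \<omega>. \<omega> \<in> space M \<Longrightarrow> 0 \<le> \<eta> s \<omega>"
    and infinite_mean: "(\<integral>\<^sup>+ \<omega>. ennreal (\<eta> 0 \<omega>) \<partial>M) = \<infinity>"
    and t: "0 < t"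
  shows "AE \<omega> in M. \<forall>C::real. \<exists>n. ennreal (C * real (Suc n)) < (\<integral>\<^sup>+u\<in>{0..real (Suc n) * t}. ennreal (\<eta> u \<omega>) \<partial>lborel)"
proof -
  define m where "m k = (\<integral>\<^sup>+\<omega>. min (ennreal (\<eta> 0 \<omega>)) (ennreal (real k)) \<partial>M)" for k :: nat
  have "(SUP k. m k) = (\<integral>\<^sup>+\<omega>. (SUP k. min (ennreal (\<eta> 0 \<omega>)) (ennreal (real k))) \<partial>M)"
    unfolding m_def
    by (rule nn_integral_monotone_convergence_SUP[symmetric])
      (auto simp: incseq_def le_fun_def simp del: min.bounded_iff intro!: min.mono ennreal_leI)
  also have "\<dots> = (\<integral>\<^sup>+\<omega>. ennreal (\<eta> 0 \<omega>) \<partial>M)"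
  proof (intro nn_integral_cong antisym SUP_least)
    fix \<omega>
    have "min (ennreal (\<eta> 0 \<omega>)) (ennreal (real (nat \<lceil>\<eta> 0 \<omega>\<rceil>))) = ennreal (\<eta> 0 \<omega>)"
      by (intro min_absorb1 ennreal_leI) linarith
    then show "ennreal (\<eta> 0 \<omega>) \<le> (SUP k. min (ennreal (\<eta> 0 \<omega>)) (ennreal (real k)))"
      by (metis SUP_upper UNIV_I)
  qed simp
  finally have SUP_m: "(SUP k. m k) = \<infinity>"
    using infinite_mean by simp
  have "AE \<omega> in M. \<forall>k. ennreal t * m k
    \<le> limsup (\<lambda>n. (\<integral>\<^sup>+u\<in>{0..real (Suc n) * t}. min (ennreal (\<eta> u \<omega>)) (ennreal (real k)) \<partial>lborel)
        / ennreal (real (Suc n)))"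
    unfolding m_def AE_all_countable
  proof
    fix k
    show "AE \<omega> in M. ennreal t * (\<integral>\<^sup>+\<omega>. min (ennreal (\<eta> 0 \<omega>)) (ennreal (real k)) \<partial>M)
      \<le> limsup (\<lambda>n. (\<integral>\<^sup>+u\<in>{0..real (Suc n) * t}. min (ennreal (\<eta> u \<omega>)) (ennreal (real k)) \<partial>lborel)
        / ennreal (real (Suc n)))"
      by (rule limsup_time_average_ge_mean[OF ergodic _ _ t, where K = "real k"]) auto
  qed
  then show ?thesis
  proof eventually_elim
    case (elim \<omega>)
    show ?case
    proof
      fix C :: real
      have "ennreal (C / t) < (SUP k. m k)"
        by (simp add: SUP_m)
      then obtain k where k: "ennreal (C / t) < m k"
        by (auto simp: less_SUP_iff)
      have "ennreal C = ennreal t * ennreal (C / t)"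
        using t by (simp flip: ennreal_mult')
      also have "\<dots> < ennreal t * m k"
        using k t by (intro ennreal_mult_strict_left_mono) auto
      finally have "ennreal C < limsup (\<lambda>n. (\<integral>\<^sup>+u\<in>{0..real (Suc n) * t}. min (ennreal (\<eta> u \<omega>)) (ennreal (real k)) \<partial>lborel)
        / ennreal (real (Suc n)))"
        using elim by (meson less_le_trans)
      then obtain n where "ennreal C < (\<integral>\<^sup>+u\<in>{0..real (Suc n) * t}. min (ennreal (\<eta> u \<omega>)) (ennreal (real k)) \<partial>lborel)
        / ennreal (real (Suc n))"
        by (metis (no_types, lifting) Limsup_bounded always_eventually not_le)
      also have "\<dots> \<le> (\<integral>\<^sup>+u\<in>{0..real (Suc n) * t}. ennreal (\<eta> u \<omega>) \<partial>lborel) / ennreal (real (Suc n))"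
        by (intro divide_right_mono_ennreal nn_integral_mono mult_right_mono) auto
      finally have less: "ennreal C < (\<integral>\<^sup>+u\<in>{0..real (Suc n) * t}. ennreal (\<eta> u \<omega>) \<partial>lborel) / ennreal (real (Suc n))" .
      have "ennreal C * ennreal (real (Suc n)) < (\<integral>\<^sup>+u\<in>{0..real (Suc n) * t}. ennreal (\<eta> u \<omega>) \<partial>lborel)"
      proof (rule ccontr)
        assume "\<not> ?thesis"
        then have "(\<integral>\<^sup>+u\<in>{0..real (Suc n) * t}. ennreal (\<eta> u \<omega>) \<partial>lborel) / ennreal (real (Suc n))
            \<le> ennreal C * ennreal (real (Suc n)) / ennreal (real (Suc n))"
          by (intro divide_right_mono_ennreal) simp
        with less show False
          by (simp add: ennreal_mult_divide_eq del: of_nat_Suc)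
      qed
      then show "\<exists>n. ennreal (C * real (Suc n)) < (\<integral>\<^sup>+u\<in>{0..real (Suc n) * t}. ennreal (\<eta> u \<omega>) \<partial>lborel)"
        by (auto simp: ennreal_mult'' simp del: of_nat_Suc)
    qed
  qed
qed

end

section \<open>Decay of the characteristic function of the walk\<close>

text \<open>
  The solution of the rate equation is \<open>exp (- integral {0..T} r)\<close>, but a bound of the right kind
  already follows from signs alone. Were \<open>\<phi>\<close> negative somewhere, it would have been nonpositive ever since
  its last time of being nonnegative, and so could not have decreased in between. Being nonnegative,
  it is decreasing, so \<open>\<phi> T\<close> may replace \<open>\<phi> u\<close> under the integral.
\<close>
lemma decay_from_rate_equation:
  fixes r \<phi> :: "real \<Rightarrow> real"
  assumes r: "\<And>u. 0 \<le> r u" and T: "0 \<le> T"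
    and r_int: "r integrable_on {0..T}"
    and r\<phi>_int: "(\<lambda>u. r u * \<phi> u) integrable_on {0..T}"
    and eq: "\<And>u. 0 \<le> u \<Longrightarrow> u \<le> T \<Longrightarrow> \<phi> u = 1 - integral {0..u} (\<lambda>v. r v * \<phi> v)"
  shows "\<phi> T * (1 + integral {0..T} r) \<le> 1"
proof -
  have cont: "continuous_on {0..T} \<phi>"
  proof (rule continuous_on_eq)
    show "continuous_on {0..T} (\<lambda>u. 1 - integral {0..u} (\<lambda>v. r v * \<phi> v))"
      by (intro continuous_intros indefinite_integral_continuous_1 r\<phi>_int)
  qed (use eq in auto)
  have sub: "(\<lambda>u. r u * \<phi> u) integrable_on {u..v}" if "0 \<le> u" "v \<le> T" for u v
    using that by (intro integrable_on_subinterval[OF r\<phi>_int]) auto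
  have increment: "\<phi> v = \<phi> u - integral {u..v} (\<lambda>w. r w * \<phi> w)"
    if "0 \<le> u" "u \<le> v" "v \<le> T" for u v
  proof -
    have "integral {0..u} (\<lambda>w. r w * \<phi> w) + integral {u..v} (\<lambda>w. r w * \<phi> w)
        = integral {0..v} (\<lambda>w. r w * \<phi> w)"
      using that by (intro Henstock_Kurzweil_Integration.integral_combine sub) auto
    then show ?thesis
      using eq[of u] eq[of v] that by simp
  qed
  have \<phi>_nonneg: "0 \<le> \<phi> v" if v: "0 \<le> v" "v \<le> T" for v
  proof (rule ccontr)
    assume neg: "\<not> 0 \<le> \<phi> v"
    define Z where "Z = {u \<in> {0..v}. 0 \<le> \<phi> u}"
    have "closed Z"
      unfolding Z_def using v
      by (intro continuous_on_closed_Collect_le continuous_on_const continuous_on_subset[OF cont]) auto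
    moreover have "bounded Z"
      by (rule bounded_subset[of "{0..v}"]) (auto simp: Z_def)
    ultimately have "compact Z"
      by (simp add: compact_eq_bounded_closed)
    moreover have "0 \<in> Z"
      using v eq[of 0] T by (simp add: Z_def)
    ultimately obtain z where z: "z \<in> Z" "\<And>u. u \<in> Z \<Longrightarrow> u \<le> z"
      using compact_attains_sup[of Z] by blast
    have zv: "0 \<le> z" "z \<le> v" "0 \<le> \<phi> z"
      using z(1) by (auto simp: Z_def)
    \<comment> \<open>From the last nonnegative time \<open>z\<close> on, the rate equation can only increase \<open>\<phi>\<close>.\<close>
    have neg_after: "\<phi> u \<le> 0" if "z < u" "u \<le> v" for u
      using z(2)[of u] that zv by (force simp: Z_def)
    have "integral {z<..<v} (\<lambda>w. r w * \<phi> w) \<le> integral {z<..<v} (\<lambda>w. 0)"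
    proof (rule integral_le)
      show "(\<lambda>w. r w * \<phi> w) integrable_on {z<..<v}"
        using sub[of z v] zv v by (simp add: integrable_on_open_interval_real)
      show "r w * \<phi> w \<le> 0" if "w \<in> {z<..<v}" for w
        using that r neg_after[of w] by (simp add: mult_nonneg_nonpos)
    qed (rule integrable_0)
    then have "integral {z..v} (\<lambda>w. r w * \<phi> w) \<le> 0"
      by (simp add: integral_open_interval_real)
    then show False
      using increment[of z v] zv v(2) neg by simp
  qed
  have "\<phi> T \<le> \<phi> u" if "0 \<le> u" "u \<le> T" for u
  proof -
    have "0 \<le> integral {u..T} (\<lambda>w. r w * \<phi> w)"
      using that r \<phi>_nonneg by (intro integral_nonneg sub) auto
    then show ?thesis
      using increment[of u T] that by simp
  qed
  then have "integral {0..T} (\<lambda>u. r u * \<phi> T) \<le> integral {0..T} (\<lambda>u. r u * \<phi> u)"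
    using r r_int by (intro integral_le r\<phi>_int integrable_on_mult_left mult_left_mono) auto
  then have "integral {0..T} r * \<phi> T \<le> 1 - \<phi> T"
    using eq[of T] T by simp
  then show ?thesis
    by (simp add: algebra_simps)
qed

text \<open>
  Integrate the Markov property at time \<open>0\<close>, where the position is almost surely constant.
\<close>
lemma law_at_time_is_transition_probability:
  assumes rw: "random_walk_among a x0 Q X"
  obtains p where "generated_by a p"
    "\<And>T y. 0 \<le> T \<Longrightarrow> measure Q {\<xi> \<in> space Q. X T \<xi> = y} = p 0 T x0 y"
proof -
  obtain p where p: "generated_by a p"
    and cond: "\<And>s t y. 0 \<le> s \<Longrightarrow> s \<le> t \<Longrightarrow>
      AE \<xi> in Q. real_cond_exp Q (natural_filtration Q X s) (indicator {\<xi> \<in> space Q. X t \<xi> = y}) \<xi>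
        = p s t (X s \<xi>) y"
    using rw unfolding random_walk_among_def by blast
  interpret prob_space Q
    using rw unfolding random_walk_among_def by blast
  have X [measurable]: "X T \<in> measurable Q (count_space UNIV)" if "0 \<le> T" for T
    using rw that unfolding random_walk_among_def by blast
  have start: "AE \<xi> in Q. X 0 \<xi> = x0"
    using rw unfolding random_walk_among_def by blast
  have generators: "{X u -` B \<inter> space Q | u B. 0 \<le> u \<and> u \<le> 0} \<subseteq> sets Q"
    using measurable_sets[OF X] by auto
  then have "sets (natural_filtration Q X 0) \<subseteq> sets Q"
    unfolding natural_filtration_def using sets.sets_into_space
    by (subst sets_measure_of) (blast, rule sets.sigma_sets_subset)
  moreover have "space (natural_filtration Q X 0) = space Q"
    by (simp add: natural_filtration_def space_measure_of_conv)
  ultimately have subalg: "subalgebra Q (natural_filtration Q X 0)"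
    by (simp add: subalgebra_def)
  interpret F: finite_measure_subalgebra Q "natural_filtration Q X 0"
    by unfold_locales (rule subalg)
  have "measure Q {\<xi> \<in> space Q. X T \<xi> = y} = p 0 T x0 y" if T: "0 \<le> T" for T y
  proof -
    define E where "E = {\<xi> \<in> space Q. X T \<xi> = y}"
    have E [measurable]: "E \<in> sets Q"
      unfolding E_def using X[OF T] by measurable
    have "measure Q E = (\<integral>\<xi>. real_cond_exp Q (natural_filtration Q X 0) (indicator E) \<xi> \<partial>Q)"
      by (subst F.real_cond_exp_int(2)) (auto simp: emeasure_eq_measure intro!: integrable_real_indicator)
    also have "\<dots> = (\<integral>\<xi>. p 0 T x0 y \<partial>Q)"
    proof (rule integral_cong_AE)
      show "AE \<xi> in Q. real_cond_exp Q (natural_filtration Q X 0) (indicator E) \<xi> = p 0 T x0 y"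
        using cond[of 0 T y] start T unfolding E_def by (auto elim: eventually_elim2)
    qed auto
    finally show ?thesis
      by (simp add: E_def prob_space)
  qed
  then show ?thesis
    using that p by blast
qed

lemma expectation_finite_support:
  fixes F :: "int \<Rightarrow> real"
  assumes "prob_space Q" and X: "X \<in> measurable Q (count_space UNIV)"
    and F: "finite {y. F y \<noteq> 0}"
  shows "(\<Sum>\<^sub>\<infinity>y. measure Q {\<xi> \<in> space Q. X \<xi> = y} * F y) = (\<integral>\<xi>. F (X \<xi>) \<partial>Q)"
proof -
  interpret prob_space Q by fact
  define S where "S = {y. F y \<noteq> 0}"
  have [simp]: "finite S"
    using F by (simp add: S_def)
  have E [measurable]: "{\<xi> \<in> space Q. X \<xi> = y} \<in> sets Q" for y
    using X by measurable
  have "(\<Sum>\<^sub>\<infinity>y. measure Q {\<xi> \<in> space Q. X \<xi> = y} * F y)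
      = (\<Sum>y\<in>S. measure Q {\<xi> \<in> space Q. X \<xi> = y} * F y)"
    by (subst infsum_cong_neutral[where T = S and g = "\<lambda>y. measure Q {\<xi> \<in> space Q. X \<xi> = y} * F y"])
      (auto simp: S_def F)
  also have "\<dots> = (\<integral>\<xi>. (\<Sum>y\<in>S. indicator {\<xi> \<in> space Q. X \<xi> = y} \<xi> * F y) \<partial>Q)"
    by (subst Bochner_Integration.integral_sum)
      (auto intro!: integrable_mult_left integrable_real_indicator simp: emeasure_eq_measure)
  also have "\<dots> = (\<integral>\<xi>. F (X \<xi>) \<partial>Q)"
  proof (rule Bochner_Integration.integral_cong)
    fix \<xi> assume "\<xi> \<in> space Q"
    then have "(\<Sum>y\<in>S. indicator {\<xi> \<in> space Q. X \<xi> = y} \<xi> * F y) = (\<Sum>y\<in>S. if y = X \<xi> then F y else 0)"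
      by (intro sum.cong) auto
    also have "\<dots> = (if X \<xi> \<in> S then F (X \<xi>) else 0)"
      by simp
    finally show "(\<Sum>y\<in>S. indicator {\<xi> \<in> space Q. X \<xi> = y} \<xi> * F y) = F (X \<xi>)"
      by (simp add: S_def split: if_splits)
  qed simp
  finally show ?thesis .
qed


text \<open>
  When all conductances at time \<open>u\<close> equal \<open>h u\<close>, the function \<open>\<lambda>x. cos (\<theta> * x)\<close> is an eigenfunction
  of the generator with eigenvalue \<open>- 2 * (1 - cos \<theta>) * h u\<close>. The forward equation is available for
  finitely supported functions only, so the cosine is cut off outside \<open>{-N..N}\<close>; the discrete
  Laplacian \<open>\<Delta> N\<close> of the cut-off function is bounded by \<open>4\<close>, and dominated convergence, applied
  first to the law of the walk and then over time with the integrable bound \<open>4 * h\<close>, removes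
  the cut-off.
\<close>
lemma expected_cosine_rate_equation:
  fixes a :: conductances and h :: "real \<Rightarrow> real" and \<theta> :: real
  assumes rw: "random_walk_among a 0 Q X"
    and gen: "\<And>u f x. generator a u f x = h u * (f (x + 1) + f (x - 1) - 2 * f x)"
    and h: "\<And>u. 0 \<le> h u" and T: "0 \<le> T"
    and h_int: "set_integrable lborel {0..T} h"
  defines "r \<equiv> \<lambda>u. 2 * (1 - cos \<theta>) * h u"
    and "\<phi> \<equiv> \<lambda>u. \<integral>\<xi>. cos (\<theta> * real_of_int (X u \<xi>)) \<partial>Q"
  shows "set_integrable lborel {0..T} (\<lambda>u. r u * \<phi> u)" (is ?integrable)
    and "\<phi> T = 1 - (LINT u:{0..T}|lborel. r u * \<phi> u)" (is ?equation)
proof -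
  interpret prob_space Q
    using rw unfolding random_walk_among_def by blast
  have X [measurable]: "X u \<in> measurable Q (count_space UNIV)" if "0 \<le> u" for u
    using rw that unfolding random_walk_among_def by blast
  obtain p where p: "generated_by a p"
    and law: "\<And>u y. 0 \<le> u \<Longrightarrow> measure Q {\<xi> \<in> space Q. X u \<xi> = y} = p 0 u 0 y"
    using law_at_time_is_transition_probability[OF rw] by blast
  define F where "F N y = (if \<bar>y\<bar> \<le> int N then cos (\<theta> * real_of_int y) else 0)" for N y
  define \<Delta> where "\<Delta> N y = F N (y + 1) + F N (y - 1) - 2 * F N y" for N y
  define G where "G N u = (\<Sum>\<^sub>\<infinity>y. p 0 u 0 y * generator a u (F N) y)" for N u
  have finite_F: "finite {y. F N y \<noteq> 0}" for N
    by (rule finite_subset[of _ "{- int N..int N}"]) (auto simp: F_def split: if_splits)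
  have finite_\<Delta>: "finite {y. h u * \<Delta> N y \<noteq> 0}" for N u
    by (rule finite_subset[of _ "{- int N - 1..int N + 1}"]) (auto simp: \<Delta>_def F_def split: if_splits)
  have abs_F: "\<bar>F N y\<bar> \<le> 1" for N y
    by (simp add: F_def)
  have abs_\<Delta>: "\<bar>\<Delta> N y\<bar> \<le> 4" for N y
    using abs_F[of N "y + 1"] abs_F[of N "y - 1"] abs_F[of N y] unfolding \<Delta>_def by linarith
  have G_int: "set_integrable lborel {0..T} (G N)"
    and G_eq: "(\<Sum>\<^sub>\<infinity>y. p 0 T 0 y * F N y) = F N 0 + (LINT u:{0..T}|lborel. G N u)" for N
    using p T finite_F[of N] unfolding generated_by_def G_def by blast+
  have expectation: "(\<Sum>\<^sub>\<infinity>y. p 0 u 0 y * f y) = (\<integral>\<xi>. f (X u \<xi>) \<partial>Q)"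
    if "0 \<le> u" "finite {y. f y \<noteq> 0}" for u and f :: "int \<Rightarrow> real"
    using expectation_finite_support[OF prob_space_axioms X[OF that(1)] that(2)] law[OF that(1)] by simp
  have G: "G N u = h u * (\<integral>\<xi>. \<Delta> N (X u \<xi>) \<partial>Q)" if "0 \<le> u" for N u
    using expectation[OF that finite_\<Delta>] unfolding G_def gen by (simp add: \<Delta>_def)
  have F_lim: "(\<lambda>N. F N y) \<longlonglongrightarrow> cos (\<theta> * real_of_int y)" for y
  proof (rule tendsto_eventually, rule eventually_sequentiallyI)
    show "F N y = cos (\<theta> * real_of_int y)" if "nat \<bar>y\<bar> \<le> N" for N
      using that by (simp add: F_def)
  qed
  have cos_sum: "cos (\<theta> * real_of_int (y + 1)) + cos (\<theta> * real_of_int (y - 1)) - 2 * cos (\<theta> * real_of_int y)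
      = - (2 * (1 - cos \<theta>)) * cos (\<theta> * real_of_int y)" for y
    by (simp add: distrib_left right_diff_distrib cos_add cos_diff left_diff_distrib)
  have \<Delta>_lim: "(\<lambda>N. \<Delta> N y) \<longlonglongrightarrow> - (2 * (1 - cos \<theta>)) * cos (\<theta> * real_of_int y)" for y
    unfolding \<Delta>_def cos_sum[symmetric] by (intro tendsto_intros F_lim)
  have G_lim: "(\<lambda>N. G N u) \<longlonglongrightarrow> - (r u * \<phi> u)" if u: "0 \<le> u" for u
  proof -
    note [measurable] = X[OF u]
    have "(\<lambda>N. \<integral>\<xi>. \<Delta> N (X u \<xi>) \<partial>Q) \<longlonglongrightarrow> (\<integral>\<xi>. - (2 * (1 - cos \<theta>)) * cos (\<theta> * real_of_int (X u \<xi>)) \<partial>Q)"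
      by (rule integral_dominated_convergence[where w = "\<lambda>_. 4"]) (use abs_\<Delta> \<Delta>_lim in auto)
    then have "(\<lambda>N. h u * (\<integral>\<xi>. \<Delta> N (X u \<xi>) \<partial>Q)) \<longlonglongrightarrow> h u * (- (2 * (1 - cos \<theta>)) * \<phi> u)"
      unfolding \<phi>_def by (intro tendsto_intros) simp
    then show ?thesis
      using u by (simp add: G r_def algebra_simps)
  qed
  have abs_G: "\<bar>G N u\<bar> \<le> 4 * h u" if u: "0 \<le> u" for N u
  proof -
    note [measurable] = X[OF u]
    have "\<bar>\<integral>\<xi>. \<Delta> N (X u \<xi>) \<partial>Q\<bar> \<le> (\<integral>\<xi>. \<bar>\<Delta> N (X u \<xi>)\<bar> \<partial>Q)"
      by (rule integral_abs_bound)
    also have "\<dots> \<le> (\<integral>\<xi>. 4 \<partial>Q)"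
      by (intro integral_mono integrable_const integrable_const_bound[where B = 4]) (auto simp: abs_\<Delta>)
    finally have "\<bar>\<integral>\<xi>. \<Delta> N (X u \<xi>) \<partial>Q\<bar> \<le> 4"
      by (simp add: prob_space)
    then show ?thesis
      using mult_left_mono[OF _ h[of u]] h[of u] u by (fastforce simp: G abs_mult mult.commute)
  qed
  have pointwise: "(\<lambda>N. indicator {0..T} u *\<^sub>R G N u) \<longlonglongrightarrow> indicator {0..T} u *\<^sub>R (- (r u * \<phi> u))" for u
    by (cases "u \<in> {0..T}") (simp_all add: G_lim)
  have G_meas [measurable]: "(\<lambda>u. indicator {0..T} u *\<^sub>R G N u) \<in> borel_measurable lborel" for N
    using G_int[of N] unfolding set_integrable_def by (rule borel_measurable_integrable)
  have limit_meas: "(\<lambda>u. indicator {0..T} u *\<^sub>R (- (r u * \<phi> u))) \<in> borel_measurable lborel"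
    by (rule borel_measurable_LIMSEQ_real[OF pointwise G_meas])
  have bound_int: "integrable lborel (\<lambda>u. 4 * (indicator {0..T} u *\<^sub>R h u))"
    using h_int unfolding set_integrable_def by (rule integrable_mult_right)
  have bound: "norm (indicator {0..T} u *\<^sub>R G N u) \<le> 4 * (indicator {0..T} u *\<^sub>R h u)" for N u
    using abs_G[of u N] by (simp add: indicator_def)
  have "integrable lborel (\<lambda>u. indicator {0..T} u *\<^sub>R (- (r u * \<phi> u)))"
    by (rule integrable_dominated_convergence[OF limit_meas G_meas bound_int AE_I2 AE_I2])
      (rule pointwise, rule bound)
  then show ?integrable
    by (simp add: set_integrable_def)
  have integral_lim: "(\<lambda>N. LINT u:{0..T}|lborel. G N u) \<longlonglongrightarrow> (LINT u:{0..T}|lborel. - (r u * \<phi> u))"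
    unfolding set_lebesgue_integral_def
    by (rule integral_dominated_convergence[OF limit_meas G_meas bound_int AE_I2 AE_I2])
      (rule pointwise, rule bound)
  note [measurable] = X[OF T]
  have "(\<lambda>N. \<integral>\<xi>. F N (X T \<xi>) \<partial>Q) \<longlonglongrightarrow> \<phi> T"
    unfolding \<phi>_def
    by (rule integral_dominated_convergence[where w = "\<lambda>_. 1"]) (use abs_F F_lim in auto)
  moreover have "(\<lambda>N. \<integral>\<xi>. F N (X T \<xi>) \<partial>Q) = (\<lambda>N. 1 + (LINT u:{0..T}|lborel. G N u))"
    using G_eq expectation[OF T finite_F] by (simp add: F_def)
  ultimately have "(\<lambda>N. 1 + (LINT u:{0..T}|lborel. G N u)) \<longlonglongrightarrow> \<phi> T"
    by simp
  moreover have "(\<lambda>N. 1 + (LINT u:{0..T}|lborel. G N u)) \<longlonglongrightarrow> 1 + (LINT u:{0..T}|lborel. - (r u * \<phi> u))"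
    by (intro tendsto_intros integral_lim)
  ultimately have "\<phi> T = 1 + (LINT u:{0..T}|lborel. - (r u * \<phi> u))"
    by (rule LIMSEQ_unique)
  then show ?equation
    by (simp add: set_lebesgue_integral_def)
qed

lemma expected_cosine_decay:
  fixes a :: conductances and h :: "real \<Rightarrow> real" and \<theta> :: real
  assumes rw: "random_walk_among a 0 Q X"
    and gen: "\<And>u f x. generator a u f x = h u * (f (x + 1) + f (x - 1) - 2 * f x)"
    and h: "\<And>u. 0 \<le> h u" and T: "0 \<le> T"
    and h_int: "set_integrable lborel {0..T} h"
  shows "(\<integral>\<xi>. cos (\<theta> * real_of_int (X T \<xi>)) \<partial>Q)
    * (1 + 2 * (1 - cos \<theta>) * (LINT u:{0..T}|lborel. h u)) \<le> 1"
proof -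
  define r where "r u = 2 * (1 - cos \<theta>) * h u" for u
  define \<phi> where "\<phi> u = (\<integral>\<xi>. cos (\<theta> * real_of_int (X u \<xi>)) \<partial>Q)" for u
  have sub: "set_integrable lborel {0..u} h" if "u \<le> T" for u
    using that by (intro set_integrable_subset[OF h_int]) auto
  have r\<phi>: "set_integrable lborel {0..u} (\<lambda>u. r u * \<phi> u)"
      "\<phi> u = 1 - (LINT u:{0..u}|lborel. r u * \<phi> u)" if "0 \<le> u" "u \<le> T" for u
    using expected_cosine_rate_equation[OF rw gen h that(1) sub[OF that(2)], of \<theta>]
    unfolding r_def \<phi>_def by blast+
  have r_int: "set_integrable lborel {0..T} r"
    unfolding r_def using h_int by (intro set_integrable_mult_right) auto
  have "\<phi> T * (1 + integral {0..T} r) \<le> 1"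
  proof (rule decay_from_rate_equation[OF _ T])
    show "0 \<le> r u" for u
      using h by (simp add: r_def)
    show "r integrable_on {0..T}"
      by (rule set_borel_integral_eq_integral(1)[OF r_int])
    show "(\<lambda>u. r u * \<phi> u) integrable_on {0..T}"
      by (rule set_borel_integral_eq_integral(1)[OF r\<phi>(1)]) (use T in auto)
    show "\<phi> u = 1 - integral {0..u} (\<lambda>v. r v * \<phi> v)" if "0 \<le> u" "u \<le> T" for u
      using r\<phi>(2)[OF that] unfolding set_borel_integral_eq_integral(2)[OF r\<phi>(1)[OF that]] .
  qed
  also have "integral {0..T} r = 2 * (1 - cos \<theta>) * (LINT u:{0..T}|lborel. h u)"
    using set_borel_integral_eq_integral(2)[OF r_int] by (simp add: r_def)
  finally show ?thesis
    by (simp add: \<phi>_def)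
qed

lemma cos_ge_one_minus_half_square: "1 - x\<^sup>2 / 2 \<le> cos (x::real)"
proof -
  have "(sin (x / 2))\<^sup>2 \<le> (x / 2)\<^sup>2"
    unfolding abs_le_square_iff[symmetric] by (rule abs_sin_x_le_abs_x)
  moreover have "(x / 2)\<^sup>2 = x\<^sup>2 / 4"
    by (simp add: power_divide)
  moreover have "cos x = cos (2 * (x / 2))"
    by simp
  moreover have "cos (2 * (x / 2)) = 1 - 2 * (sin (x / 2))\<^sup>2"
    by (rule cos_double_sin)
  ultimately show ?thesis
    by linarith
qed

text \<open>
  By the half-angle formula this reduces to \<open>\<bar>y / 2\<bar> \<le> \<bar>sin y\<bar>\<close> for \<open>y = x / 2\<close>, where the cubic Taylor
  remainder of the sine is small compared with \<open>y\<close>.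
\<close>
lemma one_minus_cos_ge:
  assumes "\<bar>x\<bar> \<le> (1::real)"
  shows "x\<^sup>2 / 8 \<le> 1 - cos x"
proof -
  define y where "y = x / 2"
  have y: "\<bar>y\<bar> \<le> 1"
    using assms by (simp add: y_def)
  have "\<bar>sin y - y\<bar> \<le> \<bar>y\<bar> ^ 3 / 6"
    using Maclaurin_sin_bound[of y 3] by (simp add: sin_coeff_def lessThan_nat_numeral fact_numeral divide_simps)
  also have "\<dots> \<le> \<bar>y\<bar> / 6"
    using power_le_one[of "\<bar>y\<bar>" 2] y mult_left_mono[of "\<bar>y\<bar> ^ 2" 1 "\<bar>y\<bar>"]
    by (simp add: power3_eq_cube power2_eq_square)
  finally have "\<bar>y / 2\<bar> \<le> \<bar>sin y\<bar>"
    by linarith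
  then have "(y / 2)\<^sup>2 \<le> (sin y)\<^sup>2"
    by (simp only: abs_le_square_iff)
  then show ?thesis
    using cos_double_sin[of y] by (simp add: y_def power_divide)
qed

section \<open>Failure of tightness\<close>

text \<open>
  Under tightness most of the mass of \<open>X (real (Suc n) * t)\<close> would lie within \<open>R * sqrt (real (Suc n))\<close>
  of the origin, with \<open>R\<close> independent of \<open>n\<close>. At the frequency \<open>\<theta> = 1 / (R * sqrt (real (Suc n)))\<close> the
  cosine is at least \<open>1 / 2\<close> there, which keeps its expectation at or above \<open>1 / 8\<close>. Since
  \<open>1 - cos \<theta>\<close> is of order \<open>\<theta>\<^sup>2\<close>, the decay estimate then bounds the integrated conductance
  by a fixed multiple of \<open>real (Suc n)\<close>.
\<close>
lemma not_tight_if_clock_superlinear: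
  fixes a :: conductances and h :: "real \<Rightarrow> real" and t :: real
  assumes rw: "random_walk_among a 0 Q X"
    and gen: "\<And>u f x. generator a u f x = h u * (f (x + 1) + f (x - 1) - 2 * f x)"
    and h: "\<And>u. 0 \<le> h u" and h_int: "\<And>T. set_integrable lborel {0..T} h"
    and t: "0 < t"
    and superlinear: "\<And>C. \<exists>n. C * real (Suc n) < (LINT u:{0..real (Suc n) * t}|lborel. h u)"
  shows "\<not> tight (\<lambda>n. distr Q borel (\<lambda>\<xi>. real_of_int (X (real (Suc n) * t) \<xi>) / sqrt (real (Suc n))))"
proof
  assume tight: "tight (\<lambda>n. distr Q borel (\<lambda>\<xi>. real_of_int (X (real (Suc n) * t) \<xi>) / sqrt (real (Suc n))))"
  interpret prob_space Q
    using rw unfolding random_walk_among_def by blast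
  \<comment> \<open>Mass \<open>3 / 4\<close> at cosine \<open>1 / 2\<close> outweighs mass \<open>1 / 4\<close> at cosine \<open>- 1\<close>, leaving \<open>1 / 8\<close>.\<close>
  obtain b c where bc: "\<And>n. 1 - 1 / 4 < measure (distr Q borel
      (\<lambda>\<xi>. real_of_int (X (real (Suc n) * t) \<xi>) / sqrt (real (Suc n)))) {b<..c}"
    using tight unfolding tight_def by (metis zero_less_divide_1_iff zero_less_numeral)
  define R where "R = \<bar>b\<bar> + \<bar>c\<bar> + 1"
  have R: "1 \<le> R"
    by (simp add: R_def)
  \<comment> \<open>With \<open>1 / 8 \<le> \<phi>\<close>, the decay estimate gives \<open>2 * (\<theta>\<^sup>2 / 8) * \<Lambda> \<le> 7\<close>, that is \<open>\<theta>\<^sup>2 * \<Lambda> \<le> 28\<close>.\<close>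
  obtain n where n: "28 * R\<^sup>2 * real (Suc n) < (LINT u:{0..real (Suc n) * t}|lborel. h u)"
    using superlinear by blast
  define T where "T = real (Suc n) * t"
  define s where "s = sqrt (real (Suc n))"
  define \<Lambda> where "\<Lambda> = (LINT u:{0..T}|lborel. h u)"
  define \<theta> where "\<theta> = 1 / (R * s)"
  have T: "0 \<le> T"
    using t by (simp add: T_def)
  have s: "1 \<le> s" "s\<^sup>2 = real (Suc n)"
    by (simp_all add: s_def)
  have X [measurable]: "X T \<in> measurable Q (count_space UNIV)"
    using rw T unfolding random_walk_among_def by blast
  define B where "B = {\<xi> \<in> space Q. real_of_int (X T \<xi>) / s \<in> {b<..c}}"
  have B [measurable]: "B \<in> sets Q"
    unfolding B_def by measurable
  have "(\<lambda>\<xi>. real_of_int (X T \<xi>) / s) -` {b<..c} \<inter> space Q = B"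
    by (auto simp: B_def)
  then have B_prob: "3 / 4 < prob B"
    using bc[of n] unfolding T_def[symmetric] s_def[symmetric] by (subst (asm) measure_distr) auto
  \<comment> \<open>On \<open>B\<close> the right side is at least \<open>1 / 2\<close>, elsewhere only at least \<open>- 1\<close>.\<close>
  have cos_ge: "3 / 2 * indicator B \<xi> - 1 \<le> cos (\<theta> * real_of_int (X T \<xi>))" for \<xi>
  proof (cases "\<xi> \<in> B")
    case True
    then have "\<bar>real_of_int (X T \<xi>) / s\<bar> \<le> R"
      unfolding B_def R_def by auto
    then have "\<bar>\<theta> * real_of_int (X T \<xi>)\<bar> \<le> 1"
      using R s by (simp add: \<theta>_def abs_mult field_simps)
    then have "(\<theta> * real_of_int (X T \<xi>))\<^sup>2 \<le> 1"
      by (simp add: abs_square_le_1)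
    then show ?thesis
      using cos_ge_one_minus_half_square[of "\<theta> * real_of_int (X T \<xi>)"] True by simp
  qed simp
  have "1 / 8 \<le> 3 / 2 * prob B - 1"
    using B_prob by simp
  also have "\<dots> = (\<integral>\<xi>. 3 / 2 * indicator B \<xi> - 1 \<partial>Q)"
    by (subst Bochner_Integration.integral_diff)
      (auto simp: prob_space emeasure_eq_measure intro!: integrable_real_indicator)
  also have "\<dots> \<le> (\<integral>\<xi>. cos (\<theta> * real_of_int (X T \<xi>)) \<partial>Q)"
  proof (rule integral_mono)
    show "integrable Q (\<lambda>\<xi>. cos (\<theta> * real_of_int (X T \<xi>)))"
      by (rule integrable_const_bound[where B = 1]) auto
    show "3 / 2 * indicator B \<xi> - 1 \<le> cos (\<theta> * real_of_int (X T \<xi>))" for \<xi>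
      by (rule cos_ge)
  qed (auto simp: emeasure_eq_measure intro!: integrable_real_indicator)
  finally have cosine: "1 / 8 \<le> (\<integral>\<xi>. cos (\<theta> * real_of_int (X T \<xi>)) \<partial>Q)" .
  have \<Lambda>: "0 \<le> \<Lambda>"
    unfolding \<Lambda>_def set_lebesgue_integral_def using h by (intro Bochner_Integration.integral_nonneg) auto
  have "\<bar>\<theta>\<bar> \<le> 1"
    using R s mult_mono[of 1 R 1 s] by (simp add: \<theta>_def)
  then have "\<theta>\<^sup>2 / 8 \<le> 1 - cos \<theta>"
    by (rule one_minus_cos_ge)
  then have "1 + 2 * (\<theta>\<^sup>2 / 8) * \<Lambda> \<le> 1 + 2 * (1 - cos \<theta>) * \<Lambda>"
    using \<Lambda> by (intro add_left_mono mult_right_mono) auto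
  then have "1 / 8 * (1 + 2 * (\<theta>\<^sup>2 / 8) * \<Lambda>)
      \<le> (\<integral>\<xi>. cos (\<theta> * real_of_int (X T \<xi>)) \<partial>Q) * (1 + 2 * (1 - cos \<theta>) * \<Lambda>)"
    using cosine \<Lambda> by (intro mult_mono) auto
  also have "\<dots> \<le> 1"
    unfolding \<Lambda>_def by (rule expected_cosine_decay[OF rw gen h T h_int])
  finally have "\<theta>\<^sup>2 * \<Lambda> \<le> 28"
    by simp
  moreover have "\<theta>\<^sup>2 = 1 / (R\<^sup>2 * real (Suc n))"
    using s(2) by (simp add: \<theta>_def power_divide power_mult_distrib)
  ultimately have "\<Lambda> \<le> 28 * R\<^sup>2 * real (Suc n)"
    using R by (simp add: field_simps del: of_nat_Suc)
  with n show False
    by (simp add: \<Lambda>_def T_def)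
qed

theorem theorem2p2:
  fixes M :: "'w measure"
    and \<eta> :: "real \<Rightarrow> 'w \<Rightarrow> real"
    and a :: "'w \<Rightarrow> conductances"
    and t :: real
  assumes "prob_space M"
    and jointly_measurable: "(\<lambda>(s, \<omega>). \<eta> s \<omega>) \<in> borel_measurable (borel \<Otimes>\<^sub>M M)"
    and positive: "\<And>s \<omega>. \<omega> \<in> space M \<Longrightarrow> 0 < \<eta> s \<omega>"
    and locally_integrable: "\<And>u v \<omega>. \<omega> \<in> space M \<Longrightarrow> set_integrable lborel {u..v} (\<lambda>s. \<eta> s \<omega>)"
    and stationary: "stationary_process M \<eta>"
    and ergodic: "ergodic_process M \<eta>"
    and conductance: "\<And>\<omega> s x. \<omega> \<in> space M \<Longrightarrow> a \<omega> s x (x + 1) = \<eta> s \<omega>"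
    and symmetric: "\<And>\<omega> s x. \<omega> \<in> space M \<Longrightarrow> a \<omega> s (x + 1) x = a \<omega> s x (x + 1)"
    and infinite_mean: "(\<integral>\<^sup>+ \<omega>. ennreal (\<eta> 0 \<omega>) \<partial>M) = \<infinity>"
    and "0 < t"
  shows "AE \<omega> in M. \<forall>(Q :: 'x measure) X. random_walk_among (a \<omega>) 0 Q X \<longrightarrow>
           \<not> tight (\<lambda>n. distr Q borel
                     (\<lambda>\<xi>. real_of_int (X (real (Suc n) * t) \<xi>) / sqrt (real (Suc n))))"
proof -
  interpret measurable_stationary_process M \<eta>
    using assms(1) jointly_measurable stationary
    by (simp add: measurable_stationary_process_def measurable_stationary_process_axioms_def)
  have "AE \<omega> in M. \<forall>C. \<exists>n. ennreal (C * real (Suc n))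
      < (\<integral>\<^sup>+u\<in>{0..real (Suc n) * t}. ennreal (\<eta> u \<omega>) \<partial>lborel)"
    using positive less_imp_le
    by (intro unbounded_time_average[OF ergodic _ infinite_mean \<open>0 < t\<close>]) blast
  then show ?thesis
    using AE_space
  proof eventually_elim
    case (elim \<omega>)
    have \<eta>_nonneg: "0 \<le> \<eta> u \<omega>" for u
      using positive[OF elim(2)] by (rule less_imp_le)
    have generator: "generator (a \<omega>) u f x = \<eta> u \<omega> * (f (x + 1) + f (x - 1) - 2 * f x)" for u f x
    proof -
      have "a \<omega> u x (x - 1) = \<eta> u \<omega>"
        using symmetric[OF elim(2), of u "x - 1"] conductance[OF elim(2), of u "x - 1"] by simp
      then show ?thesis
        using conductance[OF elim(2), of u x] by (simp add: generator_def algebra_simps)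
    qed
    have clock: "(\<integral>\<^sup>+u\<in>{0..T}. ennreal (\<eta> u \<omega>) \<partial>lborel) = ennreal (LINT u:{0..T}|lborel. \<eta> u \<omega>)" for T
    proof -
      have "(\<integral>\<^sup>+u\<in>{0..T}. ennreal (\<eta> u \<omega>) \<partial>lborel) = (\<integral>\<^sup>+u. ennreal (indicator {0..T} u *\<^sub>R \<eta> u \<omega>) \<partial>lborel)"
        by (intro nn_integral_cong) (simp split: split_indicator)
      also have "\<dots> = ennreal (\<integral>u. indicator {0..T} u *\<^sub>R \<eta> u \<omega> \<partial>lborel)"
        using locally_integrable[OF elim(2)] \<eta>_nonneg
        by (intro nn_integral_eq_integral) (auto simp: set_integrable_def)
      finally show ?thesis
        by (simp add: set_lebesgue_integral_def)
    qed
    have superlinear: "\<exists>n. C * real (Suc n) < (LINT u:{0..real (Suc n) * t}|lborel. \<eta> u \<omega>)" for C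
      using elim(1) unfolding clock by (meson ennreal_leI not_le)
    show ?case
    proof (intro allI impI)
      fix Q :: "'x measure" and X
      assume "random_walk_among (a \<omega>) 0 Q X"
      then show "\<not> tight (\<lambda>n. distr Q borel
          (\<lambda>\<xi>. real_of_int (X (real (Suc n) * t) \<xi>) / sqrt (real (Suc n))))"
        by (rule not_tight_if_clock_superlinear[OF _ generator \<eta>_nonneg locally_integrable[OF elim(2)] \<open>0 < t\<close>
              superlinear])
    qed
  qed
qed

end
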